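(* Let $q$ be a prime power. For any positive integer $n$, $$\lim_{x\to\infty}\ \sum_{\substack{A\in\mathbb{F}_q[T]\text{ monic}\\ 1\le\deg A\le x\\ \delta_1(A)=n}}\frac{\mu(A)\,\Omega(A)}{q^{\deg A}}=0.$$
   Context: A prime in $\mathbb{F}_q[T]$ is a monic irreducible polynomial. For monic $A$, $\mu(A)=1$ if $A=1$, $\mu(A)=(-1)^k$ if $A$ is a product of $k$ distinct primes, and $\mu(A)=0$ otherwise. $\mathcal{N}(A)=\{\deg P: P\text{ prime}, P\mid A\}$, $\Omega(A)=\#\mathcal{N}(A)$ is the number of distinct degrees of prime divisors of $A$ (not the number of prime factors), and $\delta_1(A)$ is the smallest element of $\mathcal{N}(A)$ (with $\delta_1(1)=0$). *)

theory Defs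
  imports "HOL-Computational_Algebra.Polynomial_Factorial" "HOL-Analysis.Analysis"
begin

text \<open>
  The library's constant \<open>prime\<close> lives in a normalization class to which \<open>'a poly\<close> with
  \<open>'a :: field\<close> does not belong, so the notion is spelled out.
\<close>

definition prime_poly :: "'a::field poly \<Rightarrow> bool" where
  "prime_poly P \<longleftrightarrow> lead_coeff P = 1 \<and> irreducible P"

text \<open>
  A product of \<open>k\<close> distinct primes is \<open>\<Prod>S\<close> for a set \<open>S\<close> of \<open>k\<close> primes; \<open>k\<close> is unique, see
  \<open>poly_moebius_Prod\<close>. The case \<open>A = 1\<close> is the empty product.
\<close>

definition poly_moebius :: "'a::field poly \<Rightarrow> int" where
  "poly_moebius A =
     (if \<exists>S. finite S \<and> (\<forall>P\<in>S. prime_poly P) \<and> A = \<Prod>S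
      then (-1) ^ (THE k. \<exists>S. finite S \<and> (\<forall>P\<in>S. prime_poly P) \<and> A = \<Prod>S \<and> card S = k)
      else 0)"

definition prime_degrees :: "'a::field poly \<Rightarrow> nat set" where
  "prime_degrees A = {degree P | P. prime_poly P \<and> P dvd A}"

definition num_prime_degrees :: "'a::field poly \<Rightarrow> nat" where
  "num_prime_degrees A = card (prime_degrees A)"

definition least_prime_degree :: "'a::field poly \<Rightarrow> nat" where
  "least_prime_degree A = (if A = 1 then 0 else Min (prime_degrees A))"

lemma prime_poly_dvd_imp_eq:
  assumes "prime_poly P" "prime_poly Q" "P dvd Q"
  shows "P = Q"
proof -
  obtain R where R: "Q = P * R" using assms(3) by (auto simp: dvd_def)
  have "is_unit R"
    using R assms(1,2) unfolding prime_poly_def by (auto simp: irreducible_def)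
  then obtain c where c: "R = [:c:]" by (auto simp: is_unit_poly_iff)
  have "lead_coeff P = 1" "lead_coeff Q = 1"
    using assms(1,2) by (auto simp: prime_poly_def)
  then have "c = 1"
    using R c lead_coeff_mult[of P R] by simp
  then show ?thesis using R c by simp
qed

lemma prime_poly_dvd_Prod_iff:
  assumes "finite S" "\<forall>Q\<in>S. prime_poly Q" "prime_poly P"
  shows "P dvd \<Prod>S \<longleftrightarrow> P \<in> S"
proof
  have pe: "prime_elem P"
    using assms(3) field_poly_irreducible_imp_prime unfolding prime_poly_def by blast
  show "P \<in> S" if "P dvd \<Prod>S"
    using assms(1,2) that
  proof (induction S)
    case empty
    then show ?case using pe by (simp add: prime_elem_def)
  next
    case (insert Q S)
    then have "P dvd Q * \<Prod>S" by simp
    then consider "P dvd Q" | "P dvd \<Prod>S"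
      using pe prime_elem_dvd_multD by blast
    then show ?case
      using insert prime_poly_dvd_imp_eq[OF assms(3)] by cases auto
  qed
  show "P dvd \<Prod>S" if "P \<in> S"
    using dvd_prodI[OF assms(1) that, of "\<lambda>x. x"] by simp
qed

lemma poly_moebius_Prod:
  assumes "finite S" "\<forall>P\<in>S. prime_poly P"
  shows "poly_moebius (\<Prod>S) = (-1) ^ card S"
proof -
  have uniq: "S' = S" if "finite S'" "\<forall>P\<in>S'. prime_poly P" "\<Prod>S = \<Prod>S'" for S'
    using prime_poly_dvd_Prod_iff[OF assms] prime_poly_dvd_Prod_iff[OF that(1,2)] that assms
    by auto
  have "(THE k. \<exists>S'. finite S' \<and> (\<forall>P\<in>S'. prime_poly P) \<and> \<Prod>S = \<Prod>S' \<and> card S' = k) = card S"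
    using assms uniq by (intro the_equality) blast+
  then show ?thesis
    using assms unfolding poly_moebius_def by auto
qed

lemma finite_prime_degrees:
  assumes "A \<noteq> 0"
  shows "finite (prime_degrees A)"
proof (rule finite_subset)
  show "prime_degrees A \<subseteq> {..degree A}"
    using assms dvd_imp_degree_le unfolding prime_degrees_def by auto
qed simp

lemma prime_degrees_nonempty:
  assumes "lead_coeff A = 1" "A \<noteq> 1"
  shows "prime_degrees A \<noteq> {}"
proof -
  have "A \<noteq> 0" using assms by auto
  have "\<not> is_unit A"
  proof
    assume "is_unit A"
    then obtain c where "A = [:c:]" by (auto simp: is_unit_poly_iff)
    with assms show False by simp
  qed
  with \<open>A \<noteq> 0\<close> have "\<exists>P. irreducible P \<and> P dvd A"
  proof (induction "degree A" arbitrary: A rule: less_induct)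
    case less
    show ?case
    proof (cases "irreducible A")
      case True
      then show ?thesis using dvd_refl by blast
    next
      case False
      then obtain B C where BC: "A = B * C" "\<not> is_unit B" "\<not> is_unit C"
        using less.prems by (auto simp: irreducible_def)
      then have "B \<noteq> 0" "C \<noteq> 0" using less.prems by auto
      then have "degree B < degree A"
        using BC by (simp add: degree_mult_eq is_unit_iff_degree)
      then show ?thesis
        using less.hyps[of B] BC \<open>B \<noteq> 0\<close> by (metis dvd_mult2)
    qed
  qed
  then obtain P where P: "irreducible P" "P dvd A" by blast
  define c where "c = inverse (lead_coeff P)"
  have "P \<noteq> 0" using P by auto
  then have c: "c \<noteq> 0" by (simp add: c_def)
  have u: "is_unit [:c:]" using c by (simp add: is_unit_pCons_iff)
  have sm: "smult c P = [:c:] * P" by simp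
  have "irreducible (smult c P)"
    unfolding sm using P(1) irreducible_mult_unit_left[OF u] by blast
  moreover have "smult c P dvd A" using P(2) c by (simp add: smult_dvd_iff)
  moreover have "lead_coeff (smult c P) = 1" using \<open>P \<noteq> 0\<close> by (simp add: c_def)
  ultimately show ?thesis unfolding prime_degrees_def prime_poly_def by blast
qed

lemma finite_polys_degree_le:
  "finite {A :: 'a::{field, finite} poly. degree A \<le> d}"
proof (rule finite_imageD)
  let ?f = "\<lambda>A :: 'a poly. map (coeff A) [0..<Suc d]"
  have "?f ` {A. degree A \<le> d} \<subseteq> {xs. set xs \<subseteq> UNIV \<and> length xs = Suc d}"
    by auto
  then show "finite (?f ` {A. degree A \<le> d})"
    using finite_lists_length_eq[of "UNIV :: 'a set" "Suc d"] finite_subset by auto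
  show "inj_on ?f {A. degree A \<le> d}"
  proof (rule inj_onI)
    fix A B :: "'a poly"
    assume *: "A \<in> {A. degree A \<le> d}" "B \<in> {A. degree A \<le> d}" "?f A = ?f B"
    show "A = B"
    proof (rule poly_eqI)
      fix n
      show "coeff A n = coeff B n"
      proof (cases "n \<le> d")
        case True
        then show ?thesis using *(3) by (auto simp del: upt_Suc)
      next
        case False
        then show ?thesis using *(1,2) by (simp add: coeff_eq_0)
      qed
    qed
  qed
qed

end

theory Submission
  imports Defs "HOL-Real_Asymp.Real_Asymp"
begin

text \<open>
  A monic \<open>A\<close> with \<open>deg A \<le> N\<close> divides exactly \<open>q ^ (N - deg A)\<close> monic \<open>M\<close> of degree \<open>N\<close>, so the
  partial sum up to \<open>N\<close> is the average over these \<open>M\<close> of \<open>\<Sum>A | A dvd M. \<mu> A * \<Omega> A\<close>, restricted to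
  \<open>\<delta>\<^sub>1 A = n\<close>. Only squarefree \<open>A\<close> matter, i.e. sets of primes dividing \<open>M\<close>, and inclusion-exclusion
  shows that the inner sum is bounded and vanishes as soon as \<open>M\<close> has prime divisors of two
  different degrees exceeding \<open>n\<close>.

  The remaining \<open>M\<close> have density zero: each is a product of primes of degree at most \<open>n\<close>, for
  which there are only polynomially many choices in a given degree, times a product of \<open>m / d\<close>
  primes of one degree \<open>d > n\<close>. Since there are at most \<open>q ^ d / d\<close> primes of degree \<open>d\<close>, the
  latter products of degree \<open>m\<close> have density at most \<open>\<Sum>d | 1 < d \<and> d dvd m. 1 / d ^ (m / d) = O(1 / m)\<close>.
\<close>

section \<open>Counting primes in polynomial rings over finite fields\<close>

definition monics :: "nat \<Rightarrow> 'a::field poly set" where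
  "monics d = {A. lead_coeff A = 1 \<and> degree A = d}"

definition primes_deg :: "nat \<Rightarrow> 'a::field poly set" where
  "primes_deg d = {P. prime_poly P \<and> degree P = d}"

lemma prime_poly_imp_prime_elem: "prime_poly P \<Longrightarrow> prime_elem P"
  using field_poly_irreducible_imp_prime unfolding prime_poly_def by blast

lemma prime_poly_degree_pos: "prime_poly P \<Longrightarrow> degree P > 0"
  using is_unit_iff_degree[of P] by (auto simp: prime_poly_def irreducible_def)

lemma finite_monics: "finite (monics d :: 'a::{field, finite} poly set)"
  by (rule finite_subset[OF _ finite_polys_degree_le[of d]]) (auto simp: monics_def)

lemma finite_primes_deg: "finite (primes_deg d :: 'a::{field, finite} poly set)"
  by (rule finite_subset[OF _ finite_polys_degree_le[of d]]) (auto simp: primes_deg_def)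

text \<open>Bounding coefficients instead of the degree keeps the count valid at
  \<open>d = 0\<close>, where only the zero polynomial remains.\<close>

lemma card_polys_coeff_zero:
  "card {A :: 'a::{field, finite} poly. \<forall>i\<ge>d. coeff A i = 0} = CARD('a) ^ d"
proof -
  have "bij_betw Poly {xs. set xs \<subseteq> UNIV \<and> length xs = d} {A :: 'a poly. \<forall>i\<ge>d. coeff A i = 0}"
  proof (rule bij_betw_byWitness[where f' = "\<lambda>A. map (coeff A) [0..<d]"])
    show "\<forall>xs\<in>{xs :: 'a list. set xs \<subseteq> UNIV \<and> length xs = d}. map (coeff (Poly xs)) [0..<d] = xs"
      by (auto intro!: nth_equalityI simp: nth_default_nth)
    show "\<forall>A\<in>{A :: 'a poly. \<forall>i\<ge>d. coeff A i = 0}. Poly (map (coeff A) [0..<d]) = A"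
      by (auto intro!: poly_eqI simp: nth_default_def)
  qed (auto simp: nth_default_def)
  then show ?thesis
    using bij_betw_same_card[of Poly] card_lists_length_eq[of "UNIV :: 'a set" d] by fastforce
qed

lemma card_monics: "card (monics d :: 'a::{field, finite} poly set) = CARD('a) ^ d"
proof -
  let ?Z = "{A :: 'a poly. \<forall>i\<ge>d. coeff A i = 0}"
  have "bij_betw (\<lambda>A. A + monom 1 d) ?Z (monics d)"
  proof (rule bij_betw_byWitness[where f' = "\<lambda>A. A - monom 1 d"])
    show "(\<lambda>A. A + monom 1 d) ` ?Z \<subseteq> monics d"
    proof safe
      fix A :: "'a poly" assume A: "\<forall>i\<ge>d. coeff A i = 0"
      then have c: "coeff (A + monom 1 d) d = 1" by simp
      have "degree (A + monom 1 d) = d"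
      proof (rule antisym)
        show "degree (A + monom 1 d) \<le> d" using A by (intro degree_le) simp
        show "d \<le> degree (A + monom 1 d)" using c by (intro le_degree) simp
      qed
      with c show "A + monom 1 d \<in> monics d" by (simp add: monics_def)
    qed
    show "(\<lambda>A. A - monom 1 d) ` monics d \<subseteq> ?Z"
      by (auto simp: monics_def coeff_eq_0 le_less)
  qed auto
  then show ?thesis
    using bij_betw_same_card[of _ ?Z "monics d"] card_polys_coeff_zero[of d, where 'a = 'a] by fastforce
qed

text \<open>Fermat's argument: multiplication by \<open>X\<close> permutes the nonzero residues modulo \<open>P\<close>.\<close>

lemma prime_poly_dvd_X_power_diff:
  fixes P :: "'a::{field, finite} poly"
  assumes "prime_poly P"
  shows "P dvd [:0, 1:] ^ (CARD('a) ^ degree P) - [:0, 1:]"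
\<comment> \<open>If \<open>P\<close> divides \<open>X\<close>, multiplication by \<open>X\<close>
  is not injective modulo \<open>P\<close>, but then \<open>P\<close> divides both terms of the
  difference.\<close>
proof (cases "P dvd [:0, 1:]")
  case True
  moreover have "[:0, 1 :: 'a:] dvd [:0, 1:] ^ (CARD('a) ^ degree P)"
    by (rule dvd_power) simp
  ultimately show ?thesis by (meson dvd_diff dvd_trans)
next
  case False
  define X where "X = [:0, 1 :: 'a:]"
  define Z where "Z = {A :: 'a poly. \<forall>i\<ge>degree P. coeff A i = 0}"
  define R where "R = Z - {0}"
  have pe: "prime_elem P" using prime_poly_imp_prime_elem[OF assms] .
  have d: "degree P > 0" using prime_poly_degree_pos[OF assms] .
  have Z: "r \<in> Z \<longleftrightarrow> degree r < degree P" for r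
  proof
    assume r: "r \<in> Z"
    show "degree r < degree P"
    proof (rule ccontr)
      assume "\<not> degree r < degree P"
      then have "lead_coeff r = 0" using r by (simp add: Z_def)
      then show False using d \<open>\<not> degree r < degree P\<close> by simp
    qed
  next
    assume "degree r < degree P"
    then show "r \<in> Z" unfolding Z_def mem_Collect_eq by (metis coeff_eq_0 order_less_le_trans)
  qed
  have P0: "P \<noteq> 0" using d by auto
  have cZ: "card Z = CARD('a) ^ degree P" unfolding Z_def by (rule card_polys_coeff_zero)
  have finZ: "finite Z" by (rule card_ge_0_finite) (simp add: cZ)
  then have finR: "finite R" by (simp add: R_def)
  have cR: "Suc (card R) = CARD('a) ^ degree P"
    using card_Suc_Diff1[OF finZ, of 0] cZ by (simp add: R_def Z_def)
  have ndvd: "\<not> P dvd r" if "r \<in> R" for r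
    using that dvd_imp_degree_le[of P r] Z[of r] by (auto simp: R_def)
  have inj: "inj_on (\<lambda>r. (X * r) mod P) R"
  proof (rule inj_onI)
    fix r s assume rs: "r \<in> R" "s \<in> R" "(X * r) mod P = (X * s) mod P"
    then have "P dvd X * (r - s)" by (simp add: mod_eq_dvd_iff algebra_simps)
    then have "P dvd r - s" using pe False prime_elem_dvd_mult_iff unfolding X_def by blast
    moreover have "degree (r - s) < degree P"
      using rs Z by (auto simp: R_def intro: degree_diff_less)
    ultimately show "r = s" using dvd_imp_degree_le[of P "r - s"] by fastforce
  qed
  have sub: "(\<lambda>r. (X * r) mod P) ` R \<subseteq> R"
  proof safe
    fix r assume r: "r \<in> R"
    have "\<not> P dvd X * r" using pe False ndvd[OF r] prime_elem_dvd_mult_iff unfolding X_def by blast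
    moreover have "degree ((X * r) mod P) < degree P"
      using degree_mod_less[OF P0, of "X * r"] d by auto
    ultimately show "(X * r) mod P \<in> R" by (simp add: R_def Z mod_eq_0_iff_dvd)
  qed
  have "(\<lambda>r. (X * r) mod P) ` R = R" using endo_inj_surj[OF finR sub inj] .
  \<comment> \<open>A permutation preserves the product of all nonzero residues, so modulo
    \<open>P\<close> this product equals itself times \<open>X ^ card R\<close>. It is prime to
    \<open>P\<close> and cancels.\<close>
  then have "\<Prod>R = (\<Prod>r\<in>R. (X * r) mod P)"
    using prod.reindex[OF inj, of "\<lambda>x. x"] by simp
  then have "\<Prod>R mod P = (X ^ card R * \<Prod>R) mod P"
    by (simp add: mod_prod_eq prod.distrib)
  then have "P dvd (X ^ card R - 1) * \<Prod>R"
    by (simp add: mod_eq_dvd_iff algebra_simps dvd_diff_commute)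
  moreover have "\<not> P dvd \<Prod>R"
    using prime_elem_dvd_prod_msetE[OF pe, of "mset_set R"] finR ndvd
    by (auto simp: prod_unfold_prod_mset)
  ultimately have "P dvd X ^ card R - 1" using pe prime_elem_dvd_mult_iff by blast
  then have "P dvd X * (X ^ card R - 1)" by simp
  also have "X * (X ^ card R - 1) = X ^ Suc (card R) - X" by (simp add: algebra_simps)
  finally show ?thesis unfolding cR X_def .
qed

text \<open>Induction: a further prime divides no product of the others, so it must divide the
  cofactor.\<close>

lemma Prod_prime_poly_dvd:
  assumes "finite S" "\<forall>P\<in>S. prime_poly P" "\<forall>P\<in>S. P dvd A"
  shows "\<Prod>S dvd A"
  using assms
proof (induction S)
  case (insert Q S)
  then obtain R where R: "A = \<Prod>S * R" by (auto simp: dvd_def)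
  have "\<not> Q dvd \<Prod>S" using insert prime_poly_dvd_Prod_iff[of S Q] by auto
  then have "Q dvd R"
    using insert.prems R prime_elem_dvd_mult_iff[OF prime_poly_imp_prime_elem[of Q]] by simp
  then show ?case using insert R by (simp add: mult.commute mult_dvd_mono)
qed simp

text \<open>All primes of degree \<open>d\<close> divide \<open>X ^ (q ^ d) - X\<close>, hence so
  does their product; compare degrees.\<close>

lemma card_primes_deg_le:
  "d * card (primes_deg d :: 'a::{field, finite} poly set) \<le> CARD('a) ^ d"
proof (cases "d = 0")
  case False
  let ?S = "primes_deg d :: 'a poly set"
  define Y where "Y = [:0, 1 :: 'a:] ^ (CARD('a) ^ d) - [:0, 1:]"
  have "card {0, 1 :: 'a} \<le> CARD('a)" by (rule card_mono) auto
  then have gt: "CARD('a) ^ d > 1" using False by (intro one_less_power) auto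
  \<comment> \<open>Since \<open>q ^ d > 1\<close>, the subtracted \<open>X\<close> cannot cancel
    the leading term, which also gives \<open>Y \<noteq> 0\<close>.\<close>
  have deg: "degree Y = CARD('a) ^ d"
    unfolding Y_def diff_conv_add_uminus[of "[:0, 1 :: 'a:] ^ _"]
    using gt by (subst degree_add_eq_left) (simp_all add: degree_power_eq)
  have "\<Prod>?S dvd Y"
    unfolding Y_def
  proof (rule Prod_prime_poly_dvd[OF finite_primes_deg])
    show "\<forall>P\<in>?S. P dvd [:0, 1:] ^ (CARD('a) ^ d) - [:0, 1:]"
      using prime_poly_dvd_X_power_diff by (auto simp: primes_deg_def)
  qed (simp add: primes_deg_def)
  moreover have "Y \<noteq> 0" using deg gt by (metis degree_0 not_one_less_zero)
  ultimately have "degree (\<Prod>?S) \<le> CARD('a) ^ d" using dvd_imp_degree_le[of "\<Prod>?S" Y] deg by simp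
  moreover have "degree (\<Prod>?S) = (\<Sum>P\<in>?S. degree P)"
    by (rule degree_prod_eq_sum_degree) (auto simp: primes_deg_def prime_poly_def)
  moreover have "(\<Sum>P\<in>?S. degree P) = d * card ?S"
    by (simp add: primes_deg_def)
  ultimately show ?thesis by simp
qed simp

section \<open>Alternating sums over sets of primes\<close>

text \<open>Combinatorial form of the divisor sum: \<open>S\<close> stands for the primes dividing
  \<open>M\<close>, \<open>g\<close> for the degree, and \<open>T\<close> for the squarefree divisor
  \<open>\<Prod>T\<close>. The guard \<open>T \<noteq> {}\<close> avoids the unspecified
  \<open>Min {}\<close>.\<close>

definition alt_sum :: "nat \<Rightarrow> ('b \<Rightarrow> nat) \<Rightarrow> 'b set \<Rightarrow> real" where
  "alt_sum n g S = (\<Sum>T\<in>Pow S. if T \<noteq> {} \<and> Min (g ` T) = n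
     then (-1) ^ card T * real (card (g ` T)) else 0)"

text \<open>Expand the product of the factors \<open>1 - 1\<close> over \<open>V\<close>.\<close>

lemma sum_Pow_alternating:
  fixes V :: "'b set"
  assumes "finite V"
  shows "(\<Sum>T\<in>Pow V. (-1) ^ card T) = (if V = {} then 1 else 0 :: real)"
  using prod_diff_conv_sum[OF assms, of "\<lambda>_. 1 :: real" "\<lambda>_. 1"] assms
  by (auto simp: power_0_left)

lemma sum_Pow_alternating_subset:
  fixes V W :: "'b set"
  assumes "finite V" "W \<subseteq> V"
  shows "(\<Sum>T\<in>Pow V. (-1) ^ card T * of_bool (T \<subseteq> W)) = (if W = {} then 1 else 0 :: real)"
proof -
  have "(\<Sum>T\<in>Pow V. (-1) ^ card T * of_bool (T \<subseteq> W)) = (\<Sum>T\<in>Pow W. (-1) ^ card T :: real)"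
    using assms by (intro sum.mono_neutral_cong_right) auto
  then show ?thesis using sum_Pow_alternating finite_subset[OF assms(2,1)] by metis
qed

text \<open>Counting the values of \<open>g\<close> on \<open>T\<close> one at a time and applying
  inclusion-exclusion leaves, for each value, four alternating sums over full power sets. Such a sum
  vanishes unless its base set is empty.\<close>

lemma alt_sum_bound:
  fixes S :: "'b set"
  assumes fin: "finite S"
  shows "\<bar>alt_sum n g S\<bar> \<le> (if \<exists>d. \<forall>p\<in>S. n < g p \<longrightarrow> g p = d then 8 else 0)"
proof -
  \<comment> \<open>A set \<open>T\<close> containing an element with value below \<open>n\<close>
    has minimum below \<open>n\<close> and contributes nothing. For \<open>T \<subseteq> V\<close>
    the minimum is \<open>n\<close> exactly when \<open>n\<close> is attained.\<close>
  define V where "V = {p \<in> S. n \<le> g p}"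
  have finV: "finite V" using fin by (simp add: V_def)
  \<comment> \<open>Contribution of the single value \<open>d\<close> to the number of values of
    \<open>g\<close> on \<open>T\<close>.\<close>
  define J where "J = (\<lambda>d. \<Sum>T\<in>Pow V. (-1) ^ card T * (of_bool (n \<in> g ` T) * of_bool (d \<in> g ` T)) :: real)"
  define z where "z = (\<lambda>W :: 'b set. if W = {} then 1 else 0 :: real)"
  have "alt_sum n g S = (\<Sum>T\<in>Pow V. \<Sum>d\<in>g ` V. (-1) ^ card T * (of_bool (n \<in> g ` T) * of_bool (d \<in> g ` T)))"
    unfolding alt_sum_def
  proof (rule sum.mono_neutral_cong_right)
    show "finite (Pow S)" "Pow V \<subseteq> Pow S" using fin by (auto simp: V_def)
    show "\<forall>T\<in>Pow S - Pow V. (if T \<noteq> {} \<and> Min (g ` T) = n then (-1) ^ card T * real (card (g ` T)) else 0) = 0"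
    proof
      fix T assume T: "T \<in> Pow S - Pow V"
      then obtain p where "p \<in> T" "p \<notin> V" by auto
      with T have p: "p \<in> T" "g p < n" by (auto simp: V_def)
      have "finite T" using T fin finite_subset by blast
      then have "Min (g ` T) \<le> g p" using p by simp
      with p show "(if T \<noteq> {} \<and> Min (g ` T) = n then (-1) ^ card T * real (card (g ` T)) else 0) = 0"
        by simp
    qed
    fix T assume T: "T \<in> Pow V"
    have finT: "finite T" using T finV finite_subset by blast
    have min: "T \<noteq> {} \<and> Min (g ` T) = n \<longleftrightarrow> n \<in> g ` T"
    proof
      assume "T \<noteq> {} \<and> Min (g ` T) = n"
      then show "n \<in> g ` T" using finT Min_in[of "g ` T"] by auto
    next
      assume "n \<in> g ` T"
      then show "T \<noteq> {} \<and> Min (g ` T) = n"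
        using T finT by (auto simp: V_def intro!: Min_eqI)
    qed
    have "(\<Sum>d\<in>g ` V. of_bool (d \<in> g ` T)) = (\<Sum>d\<in>g ` T. 1 :: real)"
      using T finV by (intro sum.mono_neutral_cong_right) auto
    then have "real (card (g ` T)) = (\<Sum>d\<in>g ` V. of_bool (d \<in> g ` T))" by simp
    then show "(if T \<noteq> {} \<and> Min (g ` T) = n then (-1) ^ card T * real (card (g ` T)) else 0)
        = (\<Sum>d\<in>g ` V. (-1) ^ card T * (of_bool (n \<in> g ` T) * of_bool (d \<in> g ` T)))"
      unfolding min by (simp add: sum_distrib_left)
  qed
  also have "\<dots> = (\<Sum>d\<in>g ` V. J d)" unfolding J_def by (rule sum.swap)
  finally have eq: "alt_sum n g S = (\<Sum>d\<in>g ` V. J d)" .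
  \<comment> \<open>Inclusion-exclusion over the events that \<open>T\<close> misses the value
    \<open>n\<close> or the value \<open>d\<close>; missing a value means lying in the complement of
    its fibre.\<close>
  have J: "J d = z V - z {p\<in>V. g p \<noteq> n} - z {p\<in>V. g p \<noteq> d} + z {p\<in>V. g p \<noteq> n \<and> g p \<noteq> d}" for d
  proof -
    have ind: "of_bool (n \<in> g ` T) * of_bool (d \<in> g ` T) =
        of_bool (T \<subseteq> V) - of_bool (T \<subseteq> {p\<in>V. g p \<noteq> n}) - of_bool (T \<subseteq> {p\<in>V. g p \<noteq> d})
        + (of_bool (T \<subseteq> {p\<in>V. g p \<noteq> n \<and> g p \<noteq> d}) :: real)" if "T \<in> Pow V" for T
    proof -
      have "T \<subseteq> V" using that by simp
      moreover have "T \<subseteq> {p\<in>V. g p \<noteq> n} \<longleftrightarrow> n \<notin> g ` T" using that by auto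
      moreover have "T \<subseteq> {p\<in>V. g p \<noteq> d} \<longleftrightarrow> d \<notin> g ` T" using that by auto
      moreover have "T \<subseteq> {p\<in>V. g p \<noteq> n \<and> g p \<noteq> d} \<longleftrightarrow> n \<notin> g ` T \<and> d \<notin> g ` T" using that by auto
      ultimately show ?thesis by simp
    qed
    have "J d = (\<Sum>T\<in>Pow V. (-1) ^ card T * (of_bool (T \<subseteq> V) - of_bool (T \<subseteq> {p\<in>V. g p \<noteq> n})
        - of_bool (T \<subseteq> {p\<in>V. g p \<noteq> d}) + of_bool (T \<subseteq> {p\<in>V. g p \<noteq> n \<and> g p \<noteq> d})))"
      unfolding J_def by (rule sum.cong) (simp_all only: ind)
    also have "\<dots> = (\<Sum>T\<in>Pow V. (-1) ^ card T * of_bool (T \<subseteq> V)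
        - (-1) ^ card T * of_bool (T \<subseteq> {p\<in>V. g p \<noteq> n})
        - (-1) ^ card T * of_bool (T \<subseteq> {p\<in>V. g p \<noteq> d})
        + (-1) ^ card T * of_bool (T \<subseteq> {p\<in>V. g p \<noteq> n \<and> g p \<noteq> d}))"
      by (simp only: right_diff_distrib distrib_left)
    also have "\<dots> = z V - z {p\<in>V. g p \<noteq> n} - z {p\<in>V. g p \<noteq> d} + z {p\<in>V. g p \<noteq> n \<and> g p \<noteq> d}"
      unfolding sum.distrib sum_subtractf z_def
      using finV by (subst (1 2 3 4) sum_Pow_alternating_subset) auto
    finally show ?thesis .
  qed
  show ?thesis
  proof (cases "\<exists>d. \<forall>p\<in>S. n < g p \<longrightarrow> g p = d")
    case True
    then obtain d where d: "\<forall>p\<in>S. n < g p \<longrightarrow> g p = d" by blast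
    then have "g ` V \<subseteq> {n, d}" by (auto simp: V_def)
    then have "card (g ` V) \<le> card {n, d}" by (intro card_mono) auto
    also have "\<dots> \<le> 2" by (simp add: card_insert_if)
    finally have c: "card (g ` V) \<le> 2" .
    \<comment> \<open>Four terms of absolute value at most 1, and at most two values in
      \<open>g\<close> applied to \<open>V\<close>: this gives 8.\<close>
    have "\<bar>J d\<bar> \<le> 4" for d unfolding J z_def by simp
    then have "\<bar>\<Sum>d\<in>g ` V. J d\<bar> \<le> real (card (g ` V)) * 4"
      by (intro order.trans[OF sum_abs] sum_bounded_above) simp
    with c True show ?thesis unfolding eq by simp
  next
    case False
    have "J d = 0" for d
    proof -
      \<comment> \<open>This \<open>p\<close> lies in the smallest of the four base sets, hence in
        all of them, so all four terms vanish.\<close>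
      obtain p where "p \<in> S" "n < g p" "g p \<noteq> d" using False by blast
      then have "p \<in> {p\<in>V. g p \<noteq> n \<and> g p \<noteq> d}" by (auto simp: V_def)
      then show ?thesis unfolding J z_def by auto
    qed
    with False show ?thesis unfolding eq by simp
  qed
qed

section \<open>Partial sums as averages over divisor sums\<close>

lemma card_monics_multiples:
  fixes A :: "'a::{field, finite} poly"
  assumes "lead_coeff A = 1" "degree A \<le> N"
  shows "card {M \<in> monics N. A dvd M} = CARD('a) ^ (N - degree A)"
proof -
  have A0: "A \<noteq> 0" using assms(1) by auto
  have "{M \<in> monics N. A dvd M} = (*) A ` monics (N - degree A)"
  proof (intro equalityI subsetI)
    fix M assume "M \<in> {M \<in> monics N. A dvd M}"
    then obtain B where M: "M = A * B" "lead_coeff M = 1" "degree M = N"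
      by (auto simp: monics_def dvd_def)
    then have "B \<noteq> 0" by auto
    moreover have "lead_coeff B = 1" using M(1,2) assms(1) lead_coeff_mult[of A B] by simp
    moreover have "degree B = N - degree A" using M(1,3) A0 \<open>B \<noteq> 0\<close> by (simp add: degree_mult_eq)
    ultimately show "M \<in> (*) A ` monics (N - degree A)" using M(1) by (auto simp: monics_def)
  next
    fix M assume "M \<in> (*) A ` monics (N - degree A)"
    then obtain B where B: "M = A * B" "lead_coeff B = 1" "degree B = N - degree A"
      unfolding monics_def by blast
    then have "B \<noteq> 0" by auto
    then have "degree M = N" using B A0 assms(2) by (simp add: degree_mult_eq)
    moreover have "lead_coeff M = 1" using B assms(1) lead_coeff_mult[of A B] by simp
    ultimately show "M \<in> {M \<in> monics N. A dvd M}" using B(1) by (simp add: monics_def)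
  qed
  moreover have "inj_on ((*) A) (monics (N - degree A))" using A0 by (auto simp: inj_on_def)
  ultimately show ?thesis by (simp add: card_image card_monics)
qed

text \<open>Interchange of summation: \<open>f A\<close> occurs once for every monic multiple of
  \<open>A\<close> of degree \<open>N\<close>.\<close>

lemma sum_monics_sum_divisors:
  fixes f :: "'a::{field, finite} poly \<Rightarrow> real"
  shows "(\<Sum>M\<in>monics N. \<Sum>A | lead_coeff A = 1 \<and> A dvd M. f A) =
    (\<Sum>A | lead_coeff A = 1 \<and> degree A \<le> N. f A * real CARD('a) ^ (N - degree A))"
proof -
  define D where "D = {A :: 'a poly. lead_coeff A = 1 \<and> degree A \<le> N}"
  have finD: "finite D"
    by (rule finite_subset[OF _ finite_polys_degree_le[of N]]) (auto simp: D_def)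
  have "{A. lead_coeff A = 1 \<and> A dvd M} = {A. A \<in> D \<and> A dvd M}" if "M \<in> monics N" for M :: "'a poly"
  proof -
    have "M \<noteq> 0" "degree M = N" using that by (auto simp: monics_def)
    then show ?thesis using dvd_imp_degree_le[of _ M] by (auto simp: D_def)
  qed
  then have "(\<Sum>M\<in>monics N. \<Sum>A | lead_coeff A = 1 \<and> A dvd M. f A)
      = (\<Sum>M\<in>monics N. \<Sum>A | A \<in> D \<and> A dvd M. f A)"
    by (intro sum.cong) auto
  also have "\<dots> = (\<Sum>A\<in>D. \<Sum>M | M \<in> monics N \<and> A dvd M. f A)"
    by (rule sum.swap_restrict[OF finite_monics finD])
  also have "\<dots> = (\<Sum>A\<in>D. f A * real CARD('a) ^ (N - degree A))"
    by (intro sum.cong) (simp_all add: D_def card_monics_multiples)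
  finally show ?thesis by (simp add: D_def)
qed

definition moebius_weight :: "nat \<Rightarrow> 'a::field poly \<Rightarrow> real" where
  "moebius_weight n A = (if least_prime_degree A = n
     then of_int (poly_moebius A) * real (num_prime_degrees A) else 0)"

text \<open>The Moebius function lives on products of distinct primes, and those dividing
  \<open>M\<close> correspond bijectively to the sets \<open>T\<close> of primes dividing
  \<open>M\<close>.\<close>

lemma sum_divisors_moebius_weight:
  fixes M :: "'a::{field, finite} poly"
  assumes "M \<noteq> 0" "n \<ge> 1"
  shows "(\<Sum>A | lead_coeff A = 1 \<and> A dvd M. moebius_weight n A) =
    alt_sum n degree {P. prime_poly P \<and> P dvd M}"
proof -
  define S where "S = {P. prime_poly P \<and> P dvd M}"
  have fin_dvd: "finite {A. A dvd M}"
    by (rule finite_subset[OF _ finite_polys_degree_le[of "degree M"]])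
      (auto simp: dvd_imp_degree_le assms(1))
  then have finS: "finite S" by (rule rev_finite_subset) (auto simp: S_def)
  have sub: "finite T" "\<forall>P\<in>T. prime_poly P" "\<forall>P\<in>T. P dvd M" if "T \<in> Pow S" for T
    using that finite_subset[OF _ finS, of T] by (auto simp: S_def)
  have monic: "lead_coeff (\<Prod>T) = 1" if "\<forall>P\<in>T. prime_poly P" for T :: "'a poly set"
    using that by (simp add: lead_coeff_prod prime_poly_def)
  \<comment> \<open>\<open>T\<close> is recovered as the set of prime divisors of its product, which
    gives injectivity and identifies the prime degrees.\<close>
  have mem: "{P. prime_poly P \<and> P dvd \<Prod>T} = T" if "T \<in> Pow S" for T
  proof (intro equalityI subsetI)
    fix P assume "P \<in> {P. prime_poly P \<and> P dvd \<Prod>T}"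
    then show "P \<in> T" using prime_poly_dvd_Prod_iff[OF sub(1,2)[OF that], of P] by simp
  next
    fix P assume "P \<in> T"
    then show "P \<in> {P. prime_poly P \<and> P dvd \<Prod>T}"
      using prime_poly_dvd_Prod_iff[OF sub(1,2)[OF that], of P] sub(2)[OF that] by simp
  qed
  have inj: "inj_on Prod (Pow S)"
  proof (rule inj_onI)
    fix T U assume *: "T \<in> Pow S" "U \<in> Pow S" "\<Prod>T = \<Prod>U"
    show "T = U" using mem[OF *(1)] mem[OF *(2)] unfolding *(3) by blast
  qed
  have weight: "moebius_weight n (\<Prod>T) = (if T \<noteq> {} \<and> Min (degree ` T) = n
      then (-1) ^ card T * real (card (degree ` T)) else 0)" if T: "T \<in> Pow S" for T
  proof -
    have deg: "prime_degrees (\<Prod>T) = degree ` T"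
      unfolding prime_degrees_def using mem[OF T] by blast
    \<comment> \<open>The empty set is the divisor 1, whose least prime degree is 0 by convention;
      it gets weight 0 because \<open>n \<ge> 1\<close>.\<close>
    have "\<Prod>T = 1 \<longleftrightarrow> T = {}"
    proof
      assume *: "\<Prod>T = 1"
      have "P \<notin> T" for P
        using * mem[OF T] prime_poly_imp_prime_elem[of P] by (auto simp: prime_elem_def)
      then show "T = {}" by auto
    qed auto
    then show ?thesis
      using \<open>n \<ge> 1\<close> unfolding moebius_weight_def least_prime_degree_def num_prime_degrees_def deg
        poly_moebius_Prod[OF sub(1,2)[OF T]] by auto
  qed
  have "(\<Sum>A | lead_coeff A = 1 \<and> A dvd M. moebius_weight n A) = (\<Sum>A\<in>Prod ` Pow S. moebius_weight n A)"
  proof (rule sum.mono_neutral_right)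
    show "finite {A. lead_coeff A = 1 \<and> A dvd M}" using fin_dvd by (rule rev_finite_subset) auto
    show "Prod ` Pow S \<subseteq> {A. lead_coeff A = 1 \<and> A dvd M}"
    proof safe
      fix T assume "T \<subseteq> S"
      then have T: "T \<in> Pow S" by simp
      show "lead_coeff (\<Prod>T) = 1" using monic sub(2)[OF T] .
      show "\<Prod>T dvd M" using Prod_prime_poly_dvd[OF sub[OF T]] .
    qed
    show "\<forall>A\<in>{A. lead_coeff A = 1 \<and> A dvd M} - Prod ` Pow S. moebius_weight n A = 0"
    proof
      fix A assume A: "A \<in> {A. lead_coeff A = 1 \<and> A dvd M} - Prod ` Pow S"
      have "poly_moebius A = 0"
      proof (rule ccontr)
        assume "poly_moebius A \<noteq> 0"
        then obtain T where T: "finite T" "\<forall>P\<in>T. prime_poly P" "A = \<Prod>T"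
          by (auto simp: poly_moebius_def split: if_splits)
        have "T \<subseteq> S"
          using T A prime_poly_dvd_Prod_iff[OF T(1,2)] by (auto simp: S_def intro: dvd_trans)
        then show False using A T(3) by auto
      qed
      then show "moebius_weight n A = 0" by (simp add: moebius_weight_def)
    qed
  qed
  also have "\<dots> = (\<Sum>T\<in>Pow S. moebius_weight n (\<Prod>T))"
    by (subst sum.reindex[OF inj]) simp
  also have "\<dots> = alt_sum n degree S"
    unfolding alt_sum_def by (intro sum.cong refl weight)
  finally show ?thesis unfolding S_def .
qed

text \<open>The exceptional \<open>M\<close>, for which \<open>alt_sum_bound\<close> gives only the
  bound 8. If no prime divisor has degree above \<open>n\<close>, any \<open>d\<close> is a
  witness.\<close>

definition few_large_degrees :: "nat \<Rightarrow> nat \<Rightarrow> 'a::field poly set" where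
  "few_large_degrees n N =
     {M \<in> monics N. \<exists>d. \<forall>P\<in>{P. prime_poly P \<and> P dvd M}. n < degree P \<longrightarrow> degree P = d}"

text \<open>Multiplied by \<open>q ^ N\<close>, the partial sum becomes a sum of divisor sums over
  \<open>monics N\<close>, of which only the exceptional ones survive, each at most 8 in absolute
  value.\<close>

lemma moebius_weight_partial_sum_bound:
  assumes "n \<ge> 1"
  shows "\<bar>\<Sum>A | lead_coeff (A :: 'a poly) = 1 \<and> degree A \<le> N. moebius_weight n A / real CARD('a) ^ degree A\<bar>
    \<le> 8 * real (card (few_large_degrees n N :: 'a::{field, finite} poly set)) / real CARD('a) ^ N"
    (is "\<bar>?S\<bar> \<le> _")
proof -
  define q where "q = real CARD('a)"
  have q: "q > 0" by (simp add: q_def)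
  have "\<bar>q ^ N * ?S\<bar> = \<bar>\<Sum>A | lead_coeff A = 1 \<and> degree A \<le> N. moebius_weight n (A :: 'a poly) * q ^ (N - degree A)\<bar>"
    unfolding sum_distrib_left q_def[symmetric] using q
    by (intro arg_cong[of _ _ abs] sum.cong) (auto simp: power_diff field_simps)
  also have "\<dots> = \<bar>\<Sum>M\<in>(monics N :: 'a poly set). \<Sum>A | lead_coeff A = 1 \<and> A dvd M. moebius_weight n A\<bar>"
    unfolding sum_monics_sum_divisors q_def ..
  also have "\<dots> \<le> (\<Sum>M\<in>(monics N :: 'a poly set). \<bar>\<Sum>A | lead_coeff A = 1 \<and> A dvd M. moebius_weight n A\<bar>)"
    by (rule sum_abs)
  also have "\<dots> \<le> (\<Sum>M\<in>(monics N :: 'a poly set). if M \<in> few_large_degrees n N then 8 else 0)"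
  proof (rule sum_mono)
    fix M :: "'a poly" assume M: "M \<in> monics N"
    then have M0: "M \<noteq> 0" by (auto simp: monics_def)
    have "finite {P. prime_poly P \<and> P dvd M}"
      by (rule finite_subset[OF _ finite_polys_degree_le[of "degree M"]])
        (auto simp: dvd_imp_degree_le M0)
    note bound = alt_sum_bound[OF this, of n degree]
    have "M \<in> few_large_degrees n N \<longleftrightarrow>
        (\<exists>d. \<forall>P\<in>{P. prime_poly P \<and> P dvd M}. n < degree P \<longrightarrow> degree P = d)"
      using M by (simp add: few_large_degrees_def)
    then show "\<bar>\<Sum>A | lead_coeff A = 1 \<and> A dvd M. moebius_weight n A\<bar>
        \<le> (if M \<in> few_large_degrees n N then 8 else 0)"
      using bound unfolding sum_divisors_moebius_weight[OF M0 assms] by (simp only:)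
  qed
  also have "\<dots> = 8 * real (card (few_large_degrees n N :: 'a poly set))"
  proof -
    have "monics N \<inter> {M. M \<in> few_large_degrees n N} = (few_large_degrees n N :: 'a poly set)"
      by (auto simp: few_large_degrees_def)
    then show ?thesis by (simp add: sum.If_cases[OF finite_monics])
  qed
  finally show ?thesis using q by (simp add: abs_mult q_def field_simps)
qed

section \<open>Counting the exceptional polynomials\<close>

text \<open>Existence of the prime factorization, splitting off one monic prime at a time.\<close>

lemma monic_eq_prod_mset_primes:
  fixes M :: "'a::field poly"
  assumes "lead_coeff M = 1"
  obtains X where "\<forall>P\<in>#X. prime_poly P" "M = prod_mset X"
proof -
  have "\<exists>X. (\<forall>P\<in>#X. prime_poly P) \<and> M = prod_mset X"
    using assms
  proof (induction "degree M" arbitrary: M rule: less_induct)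
    case less
    show ?case
    proof (cases "M = 1")
      case True
      then show ?thesis by (intro exI[of _ "{#}"]) simp
    next
      case False
      then obtain P where P: "prime_poly P" "P dvd M"
        using prime_degrees_nonempty[OF less.prems] by (auto simp: prime_degrees_def)
      then obtain B where B: "M = P * B" by (auto simp: dvd_def)
      have "M \<noteq> 0" using less.prems by auto
      then have "degree M = degree P + degree B" using B by (simp add: degree_mult_eq)
      then have "degree B < degree M" using prime_poly_degree_pos[OF P(1)] by simp
      moreover have "lead_coeff B = 1"
        using B less.prems P(1) lead_coeff_mult[of P B] by (simp add: prime_poly_def)
      ultimately obtain X where "\<forall>P\<in>#X. prime_poly P" "B = prod_mset X"
        using less.hyps by blast
      with P B show ?thesis by (intro exI[of _ "add_mset P X"]) simp
    qed
  qed
  then show thesis using that by blast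
qed

lemma prod_mset_primes_nonzero:
  fixes X :: "'a::field poly multiset"
  shows "\<forall>P\<in>#X. prime_poly P \<Longrightarrow> prod_mset X \<noteq> 0"
  by (auto simp: prime_poly_def)

text \<open>Every prime has degree at least 1. This bounds the exponents in a factorization by the
  degree.\<close>

lemma size_le_degree_prod_mset_primes:
  fixes X :: "'a::field poly multiset"
  assumes "\<forall>P\<in>#X. prime_poly P"
  shows "size X \<le> degree (prod_mset X)"
  using assms
proof (induction X)
  case (add P X)
  then have "P \<noteq> 0" "prod_mset X \<noteq> 0" "degree P > 0"
    using prod_mset_primes_nonzero[of X] prime_poly_degree_pos[of P] by auto
  then show ?case using add by (simp add: degree_mult_eq)
qed simp

lemma degree_prod_mset_primes:
  fixes X :: "'a::field poly multiset"
  assumes "\<forall>P\<in>#X. prime_poly P \<and> degree P = d"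
  shows "degree (prod_mset X) = d * size X"
  using assms
proof (induction X)
  case (add P X)
  then have "P \<noteq> 0" "prod_mset X \<noteq> 0"
    using prod_mset_primes_nonzero[of X] prime_poly_degree_pos[of P] by auto
  then show ?case using add by (simp add: degree_mult_eq)
qed simp

definition small_primes :: "nat \<Rightarrow> 'a::field poly set" where
  "small_primes n = {P. prime_poly P \<and> degree P \<le> n}"

text \<open>A superset of the degree-\<open>m\<close> products of primes of degree at most
  \<open>n\<close>: bounding each exponent by \<open>m\<close> separately makes the count a plain
  power.\<close>

definition small_prime_products :: "nat \<Rightarrow> nat \<Rightarrow> 'a::field poly set" where
  "small_prime_products n m = (\<lambda>e. \<Prod>P\<in>small_primes n. P ^ e P) ` (small_primes n \<rightarrow>\<^sub>E {..m})"

text \<open>Ordered lists overcount the products but are easily counted. The empty product is listed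
  separately, since no \<open>d\<close> is available at \<open>m = 0\<close>.\<close>

definition equal_degree_products :: "nat \<Rightarrow> nat \<Rightarrow> 'a::field poly set" where
  "equal_degree_products n m = (if m = 0 then {1} else
     (\<Union>d\<in>{d\<in>{n<..m}. d dvd m}. prod_list ` {Ps. set Ps \<subseteq> primes_deg d \<and> length Ps = m div d}))"

lemma finite_small_primes: "finite (small_primes n :: 'a::{field, finite} poly set)"
  by (rule finite_subset[OF _ finite_polys_degree_le[of n]]) (auto simp: small_primes_def)

lemma finite_small_prime_products:
  "finite (small_prime_products n m :: 'a::{field, finite} poly set)"
  unfolding small_prime_products_def by (intro finite_imageI finite_PiE finite_small_primes) simp

lemma finite_equal_degree_products:
  "finite (equal_degree_products n m :: 'a::{field, finite} poly set)"
  unfolding equal_degree_products_def by (auto intro!: finite_imageI finite_lists_length_eq finite_primes_deg)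

lemma card_small_prime_products:
  "card (small_prime_products n m :: 'a::{field, finite} poly set)
    \<le> (m + 1) ^ card (small_primes n :: 'a poly set)"
proof -
  have "card (small_prime_products n m :: 'a poly set) \<le> card ((small_primes n :: 'a poly set) \<rightarrow>\<^sub>E {..m})"
    unfolding small_prime_products_def by (intro card_image_le finite_PiE finite_small_primes) simp
  also have "\<dots> = (m + 1) ^ card (small_primes n :: 'a poly set)"
    by (simp add: card_PiE finite_small_primes)
  finally show ?thesis .
qed

lemma card_equal_degree_products:
  assumes "m > 0"
  shows "card (equal_degree_products n m :: 'a::{field, finite} poly set)
    \<le> (\<Sum>d | d \<in> {n<..m} \<and> d dvd m. card (primes_deg d :: 'a poly set) ^ (m div d))"
proof -
  have "card (equal_degree_products n m :: 'a poly set)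
      \<le> (\<Sum>d | d \<in> {n<..m} \<and> d dvd m.
          card (prod_list ` {Ps. set Ps \<subseteq> (primes_deg d :: 'a poly set) \<and> length Ps = m div d}))"
    using assms unfolding equal_degree_products_def by (simp add: card_UN_le)
  also have "\<dots> \<le> (\<Sum>d | d \<in> {n<..m} \<and> d dvd m. card (primes_deg d :: 'a poly set) ^ (m div d))"
  proof (rule sum_mono)
    fix d
    have "card (prod_list ` {Ps. set Ps \<subseteq> (primes_deg d :: 'a poly set) \<and> length Ps = m div d})
        \<le> card {Ps. set Ps \<subseteq> (primes_deg d :: 'a poly set) \<and> length Ps = m div d}"
      by (intro card_image_le finite_lists_length_eq finite_primes_deg)
    then show "card (prod_list ` {Ps. set Ps \<subseteq> (primes_deg d :: 'a poly set) \<and> length Ps = m div d})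
        \<le> card (primes_deg d :: 'a poly set) ^ (m div d)"
      by (simp add: card_lists_length_eq finite_primes_deg)
  qed
  finally show ?thesis .
qed

text \<open>Split the prime factorization at degree \<open>n\<close>: the primes above
  \<open>n\<close> all share one degree \<open>d\<close>, and \<open>k\<close> is the degree of the
  remaining part.\<close>

lemma few_large_degrees_subset:
  "(few_large_degrees n N :: 'a::{field, finite} poly set)
    \<subseteq> (\<Union>k\<le>N. (\<lambda>(B, C). B * C) ` (small_prime_products n k \<times> equal_degree_products n (N - k)))"
proof
  fix M :: "'a poly" assume "M \<in> few_large_degrees n N"
  then obtain d where monic: "lead_coeff M = 1" and deg: "degree M = N"
    and d: "\<And>P. prime_poly P \<Longrightarrow> P dvd M \<Longrightarrow> n < degree P \<Longrightarrow> degree P = d"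
    unfolding few_large_degrees_def monics_def by blast
  obtain X where X: "\<forall>P\<in>#X. prime_poly P" "M = prod_mset X"
    using monic_eq_prod_mset_primes[OF monic] .
  define Y where "Y = filter_mset (\<lambda>P. degree P \<le> n) X"
  define Z where "Z = filter_mset (\<lambda>P. \<not> degree P \<le> n) X"
  define k where "k = degree (prod_mset Y)"
  have YZ: "M = prod_mset Y * prod_mset Z"
    using X(2) multiset_partition[of X "\<lambda>P. degree P \<le> n"]
    by (simp add: Y_def Z_def flip: prod_mset_Un)
  have prY: "\<forall>P\<in>#Y. prime_poly P" and prZ: "\<forall>P\<in>#Z. prime_poly P"
    using X(1) by (auto simp: Y_def Z_def)
  have N: "N = k + degree (prod_mset Z)"
    using deg YZ prod_mset_primes_nonzero[OF prY] prod_mset_primes_nonzero[OF prZ]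
    by (simp add: degree_mult_eq k_def)
  have "prod_mset Y \<in> small_prime_products n k"
    unfolding small_prime_products_def
  proof (rule image_eqI)
    \<comment> \<open>Multiplicities are at most \<open>size Y\<close>, hence at most
      \<open>k\<close>; small primes outside \<open>Y\<close> get exponent 0.\<close>
    let ?e = "restrict (count Y) (small_primes n)"
    show "?e \<in> small_primes n \<rightarrow>\<^sub>E {..k}"
      using size_le_degree_prod_mset_primes[OF prY] count_le_size[of Y]
      by (auto simp: k_def intro: order.trans)
    have "prod_mset Y = (\<Prod>P\<in>set_mset Y. P ^ count Y P)" by (rule prod_mset_multiplicity)
    also have "\<dots> = (\<Prod>P\<in>small_primes n. P ^ ?e P)"
      using prY by (intro prod.mono_neutral_cong_left finite_small_primes)
        (auto simp: small_primes_def Y_def, metis count_eq_zero_iff power_0)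
    finally show "prod_mset Y = (\<Prod>P\<in>small_primes n. P ^ ?e P)" .
  qed
  moreover have "prod_mset Z \<in> equal_degree_products n (N - k)"
  proof (cases "Z = {#}")
    case True
    then show ?thesis using N by (simp add: equal_degree_products_def)
  next
    case False
    then obtain P where P: "P \<in># Z" by blast
    have dZ: "\<forall>P\<in>#Z. prime_poly P \<and> degree P = d"
    proof
      fix P assume "P \<in># Z"
      moreover from this have "P dvd M" unfolding X(2) by (intro dvd_prod_mset) (simp add: Z_def)
      ultimately show "prime_poly P \<and> degree P = d" using d prZ by (auto simp: Z_def)
    qed
    then have "n < d" using P by (auto simp: Z_def)
    obtain Ps where Ps: "mset Ps = Z" using ex_mset by blast
    have "size Z > 0" using False by (simp add: nonempty_has_size)
    then have m: "N - k = d * size Z" "N - k \<noteq> 0" "(N - k) div d = size Z"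
      using N degree_prod_mset_primes[OF dZ] \<open>n < d\<close> False by simp_all
    have "d \<in> {d \<in> {n<..N - k}. d dvd N - k}"
      using m(1) \<open>n < d\<close> \<open>size Z > 0\<close> by simp
    moreover have "set Ps \<subseteq> primes_deg d" using dZ Ps by (auto simp: primes_deg_def)
    moreover have "prod_mset Z = prod_list Ps" using Ps prod_mset_prod_list by blast
    moreover have "length Ps = (N - k) div d" using Ps m(3) by auto
    ultimately show ?thesis using m(2) unfolding equal_degree_products_def by auto
  qed
  ultimately show "M \<in> (\<Union>k\<le>N. (\<lambda>(B, C). B * C) ` (small_prime_products n k \<times> equal_degree_products n (N - k)))"
    using N YZ by (intro UN_I[of k]) auto
qed

lemma card_few_large_degrees:
  "card (few_large_degrees n N :: 'a::{field, finite} poly set)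
    \<le> (\<Sum>k\<le>N. (k + 1) ^ card (small_primes n :: 'a poly set)
          * card (equal_degree_products n (N - k) :: 'a poly set))"
proof -
  let ?I = "\<lambda>k. (\<lambda>(B, C). B * C) ` (small_prime_products n k \<times> equal_degree_products n (N - k)) :: 'a poly set"
  have fin: "finite (small_prime_products n k \<times> equal_degree_products n (N - k) :: ('a poly \<times> 'a poly) set)" for k
    by (intro finite_cartesian_product finite_small_prime_products finite_equal_degree_products)
  have "card (few_large_degrees n N :: 'a poly set) \<le> card (\<Union>k\<le>N. ?I k)"
    by (intro card_mono few_large_degrees_subset finite_UN_I finite_imageI fin) simp
  also have "\<dots> \<le> (\<Sum>k\<le>N. card (?I k))" by (rule card_UN_le) simp
  also have "\<dots> \<le> (\<Sum>k\<le>N. card (small_prime_products n k :: 'a poly set) * card (equal_degree_products n (N - k) :: 'a poly set))"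
    unfolding card_cartesian_product[symmetric] by (intro sum_mono card_image_le fin)
  also have "\<dots> \<le> (\<Sum>k\<le>N. (k + 1) ^ card (small_primes n :: 'a poly set)
          * card (equal_degree_products n (N - k) :: 'a poly set))"
    by (intro sum_mono mult_right_mono card_small_prime_products) simp
  finally show ?thesis .
qed

section \<open>Density of the exceptional polynomials\<close>

text \<open>Exponential decay beats any fixed power; compare with inverse squares.\<close>

lemma summable_poly_geometric:
  fixes q :: real
  assumes "q > 1"
  shows "summable (\<lambda>k. real (k + 1) ^ K / q ^ k)"
proof (rule summable_comparison_test_bigo)
  show "summable (\<lambda>k. norm (inverse (real k ^ 2)))"
    using inverse_power_summable[of 2, where 'a = real] by simp
  show "(\<lambda>k. real (k + 1) ^ K / q ^ k) \<in> O(\<lambda>k. inverse (real k ^ 2))"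
    using assms by real_asymp
qed

text \<open>For a proper divisor \<open>d \<ge> 2\<close> of \<open>m = d * j\<close> this yields
  \<open>1 / d ^ j \<le> 8 / m\<^sup>2\<close>. The case \<open>d = 2\<close> is the worst.\<close>

lemma square_le_power:
  fixes d j :: nat
  assumes "d \<ge> 2" "j \<ge> 2"
  shows "(d * j)\<^sup>2 \<le> 8 * d ^ j"
proof -
  have "j\<^sup>2 \<le> 8 * 2 ^ (j - 2)"
    using assms(2)
  proof (induction j rule: dec_induct)
    case (step i)
    show ?case
    \<comment> \<open>\<open>(i + 1)\<^sup>2 \<le> 2 * i\<^sup>2\<close> fails at
      \<open>i = 2\<close>, so the passage to 3 is checked directly.\<close>
    proof (cases "i = 2")
      case False
      then have "3 * i \<le> i * i" using step.hyps by (intro mult_right_mono) auto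
      moreover have "3 \<le> i" using step.hyps False by simp
      moreover have "(Suc i)\<^sup>2 = i * i + 2 * i + 1" by (simp add: power2_eq_square)
      ultimately have "(Suc i)\<^sup>2 \<le> 2 * i\<^sup>2" unfolding power2_eq_square by linarith
      also have "\<dots> \<le> 2 * (8 * 2 ^ (i - 2))" using step.IH by simp
      also have "\<dots> = 8 * 2 ^ Suc (i - 2)" by simp
      also have "Suc (i - 2) = Suc i - 2" using step.hyps by simp
      finally show ?thesis .
    qed (simp add: power2_eq_square)
  qed simp
  also have "\<dots> \<le> 8 * d ^ (j - 2)" using assms(1) by (simp add: power_mono)
  finally have "d\<^sup>2 * j\<^sup>2 \<le> d\<^sup>2 * (8 * d ^ (j - 2))" by (rule mult_left_mono) simp
  also have "\<dots> = 8 * d ^ (2 + (j - 2))" by (simp only: power_add ac_simps)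
  also have "2 + (j - 2) = j" using assms(2) by simp
  finally show ?thesis by (simp only: power_mult_distrib)
qed

text \<open>Tannery's theorem: for fixed \<open>k\<close> the term tends to 0, and a bound
  \<open>c\<close> for \<open>b\<close> gives the summable majorant
  \<open>\<bar>a k\<bar> * c\<close>.\<close>

lemma convolution_tendsto_zero:
  fixes a b :: "nat \<Rightarrow> real"
  assumes "summable (\<lambda>k. \<bar>a k\<bar>)" "b \<longlonglongrightarrow> 0"
  shows "(\<lambda>N. \<Sum>k\<le>N. a k * b (N - k)) \<longlonglongrightarrow> 0"
proof -
  obtain c where c: "\<And>k. \<bar>b k\<bar> \<le> c"
    using convergent_imp_Bseq[OF convergentI[OF assms(2)]] by (auto simp: Bseq_def)
  \<comment> \<open>Extension by zero turns the finite sums into series over all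
    \<open>k\<close>.\<close>
  define t where "t = (\<lambda>k N. if k \<le> N then a k * b (N - k) else 0)"
  have "(\<lambda>N. suminf (\<lambda>k. t k N)) \<longlonglongrightarrow> suminf (\<lambda>k. 0)"
  proof (rule tannerys_theorem[THEN conjunct2, THEN conjunct2])
    show "(\<lambda>N. t k N) \<longlonglongrightarrow> 0" for k
    proof (rule LIMSEQ_offset[of _ k])
      have "(\<lambda>N. a k * b N) \<longlonglongrightarrow> a k * 0" by (intro tendsto_intros assms(2))
      then show "(\<lambda>N. t k (N + k)) \<longlonglongrightarrow> 0" by (simp add: t_def)
    qed
    show "\<forall>\<^sub>F (k, N) in sequentially \<times>\<^sub>F sequentially. norm (t k N) \<le> \<bar>a k\<bar> * c"
      using c[THEN order.trans[OF abs_ge_zero]] c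
      by (intro always_eventually) (auto simp: t_def abs_mult intro: mult_left_mono)
    show "summable (\<lambda>k. \<bar>a k\<bar> * c)" using assms(1) by (rule summable_mult2)
  qed simp
  moreover have "suminf (\<lambda>k. t k N) = (\<Sum>k\<le>N. a k * b (N - k))" for N
    by (subst suminf_finite[of "{..N}"]) (auto simp: t_def)
  ultimately show ?thesis by simp
qed

lemma one_less_card_field: "real CARD('a::{field, finite}) > 1"
proof -
  have "card {0, 1 :: 'a} \<le> CARD('a)" by (rule card_mono) auto
  then show ?thesis by simp
qed

text \<open>Raise the bound \<open>card_primes_deg_le\<close> to the power
  \<open>m div d\<close>.\<close>

lemma primes_deg_ratio_le:
  assumes "d > 0" "d dvd m"
  shows "real (card (primes_deg d :: 'a::{field, finite} poly set)) ^ (m div d) / real CARD('a) ^ m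
    \<le> 1 / real d ^ (m div d)"
proof -
  let ?p = "real (card (primes_deg d :: 'a poly set))" and ?q = "real CARD('a)"
  have "real (d * card (primes_deg d :: 'a poly set)) \<le> real (CARD('a) ^ d)"
    using card_primes_deg_le by (rule of_nat_mono)
  then have "(real d * ?p) ^ (m div d) \<le> (?q ^ d) ^ (m div d)"
    by (intro power_mono) simp_all
  also have "\<dots> = ?q ^ m" using assms(2) by (simp flip: power_mult)
  finally show ?thesis using assms(1) by (simp add: power_mult_distrib field_simps)
qed

text \<open>The divisor \<open>d = m\<close> contributes at most \<open>1 / m\<close>, and each of
  the at most \<open>m\<close> others at most \<open>8 / m\<^sup>2\<close>. The hypothesis
  \<open>n \<ge> 1\<close> excludes \<open>d = 1\<close>, whose bound would be 1.\<close>

lemma equal_degree_products_ratio_le: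
  assumes "n \<ge> 1" "m > 0"
  shows "real (card (equal_degree_products n m :: 'a::{field, finite} poly set)) / real CARD('a) ^ m \<le> 9 / real m"
proof -
  let ?q = "real CARD('a)"
  let ?D = "{d. d \<in> {n<..m} \<and> d dvd m}"
  have "real (card (equal_degree_products n m :: 'a poly set)) / ?q ^ m
      \<le> real (\<Sum>d\<in>?D. card (primes_deg d :: 'a poly set) ^ (m div d)) / ?q ^ m"
    by (intro divide_right_mono of_nat_mono card_equal_degree_products assms) simp
  also have "\<dots> = (\<Sum>d\<in>?D. real (card (primes_deg d :: 'a poly set)) ^ (m div d) / ?q ^ m)"
    by (simp add: sum_divide_distrib)
  also have "\<dots> \<le> (\<Sum>d\<in>?D. (if d = m then 1 / real m else 0) + 8 / (real m)\<^sup>2)"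
  proof (rule sum_mono)
    fix d assume d: "d \<in> ?D"
    have "1 / real d ^ (m div d) \<le> (if d = m then 1 / real m else 0) + 8 / (real m)\<^sup>2"
    proof (cases "d = m")
      case False
      obtain j where j: "m = d * j" using d by (auto elim: dvdE)
      then have "j \<noteq> 0" "j \<noteq> 1" using assms(2) False by auto
      then have "j \<ge> 2" by simp
      moreover have "d \<ge> 2" using d assms(1) by auto
      ultimately have "(d * j)\<^sup>2 \<le> 8 * d ^ j" by (intro square_le_power)
      then have "real ((d * j)\<^sup>2) \<le> real (8 * d ^ j)" by (rule of_nat_mono)
      then have "(real m)\<^sup>2 \<le> 8 * real d ^ (m div d)" using \<open>d \<ge> 2\<close> j by simp
      then show ?thesis using assms(2) \<open>d \<ge> 2\<close> False by (simp add: field_simps)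
    qed (use assms(2) in simp)
    then show "real (card (primes_deg d :: 'a poly set)) ^ (m div d) / ?q ^ m
        \<le> (if d = m then 1 / real m else 0) + 8 / (real m)\<^sup>2"
      using primes_deg_ratio_le[of d m, where 'a = 'a] d by auto
  qed
  also have "\<dots> \<le> (\<Sum>d\<in>{1..m}. (if d = m then 1 / real m else 0) + 8 / (real m)\<^sup>2)"
    using assms(1) by (intro sum_mono2) auto
  also have "\<dots> = 1 / real m + real m * (8 / (real m)\<^sup>2)"
    using assms(2) by (simp add: sum.distrib)
  also have "\<dots> = 9 / real m"
    using assms(2) by (simp add: power2_eq_square field_simps)
  finally show ?thesis .
qed

text \<open>The density is dominated by a convolution of a summable sequence (small primes) with a
  null sequence (large primes).\<close>

lemma few_large_degrees_density:
  assumes "n \<ge> 1"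
  shows "(\<lambda>N. real (card (few_large_degrees n N :: 'a::{field, finite} poly set)) / real CARD('a) ^ N)
    \<longlonglongrightarrow> 0"
proof -
  define q where "q = real CARD('a)"
  define K where "K = card (small_primes n :: 'a poly set)"
  define a where "a = (\<lambda>k. real (k + 1) ^ K / q ^ k)"
  define b where "b = (\<lambda>m. real (card (equal_degree_products n m :: 'a poly set)) / q ^ m)"
  have q: "q > 1" unfolding q_def by (rule one_less_card_field)
  have "b \<longlonglongrightarrow> 0"
  proof (rule Lim_null_comparison)
    show "(\<lambda>m. 9 / real m) \<longlonglongrightarrow> 0" by real_asymp
    show "\<forall>\<^sub>F m in sequentially. norm (b m) \<le> 9 / real m"
      using equal_degree_products_ratio_le[OF assms, where 'a = 'a]
      by (intro eventually_mono[OF eventually_gt_at_top[of 0]]) (simp add: b_def q_def)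
  qed
  moreover have "summable (\<lambda>k. \<bar>a k\<bar>)"
    using summable_poly_geometric[OF q, of K] q by (simp add: a_def)
  ultimately have lim: "(\<lambda>N. \<Sum>k\<le>N. a k * b (N - k)) \<longlonglongrightarrow> 0"
    by (intro convolution_tendsto_zero)
  have "real (card (few_large_degrees n N :: 'a poly set)) / q ^ N \<le> (\<Sum>k\<le>N. a k * b (N - k))" for N
  proof -
    have "real (card (few_large_degrees n N :: 'a poly set)) / q ^ N
        \<le> real (\<Sum>k\<le>N. (k + 1) ^ K * card (equal_degree_products n (N - k) :: 'a poly set)) / q ^ N"
      using q unfolding K_def by (intro divide_right_mono of_nat_mono card_few_large_degrees) simp
    also have "\<dots> = (\<Sum>k\<le>N. a k * b (N - k))"
      unfolding of_nat_sum sum_divide_distrib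
    proof (rule sum.cong)
      fix k assume "k \<in> {..N}"
      then have "q ^ N = q ^ k * q ^ (N - k)" by (simp flip: power_add)
      then show "real ((k + 1) ^ K * card (equal_degree_products n (N - k) :: 'a poly set)) / q ^ N
          = a k * b (N - k)"
        by (simp add: a_def b_def)
    qed simp
    finally show ?thesis .
  qed
  then show ?thesis
    using q unfolding q_def[symmetric]
    by (intro real_tendsto_sandwich[OF always_eventually always_eventually tendsto_const lim]) auto
qed

section \<open>Passage from integer cutoffs to the limit over real \<open>x\<close>\<close>

theorem corollary2p5:
  fixes q n :: nat
  assumes "CARD('a::{field, finite}) = q"
    and "n \<ge> 1"
  shows "((\<lambda>x::real.
            \<Sum>A | lead_coeff (A :: 'a poly) = 1 \<and> 1 \<le> degree A \<and> real (degree A) \<le> x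
                  \<and> least_prime_degree A = n.
              of_int (poly_moebius A) * of_nat (num_prime_degrees A) / real q ^ degree A)
          \<longlongrightarrow> 0) at_top"
    (is "(?f \<longlongrightarrow> 0) at_top")
proof -
  define g where "g = (\<lambda>N. \<Sum>A | lead_coeff (A :: 'a poly) = 1 \<and> degree A \<le> N.
    moebius_weight n A / real CARD('a) ^ degree A)"
  have "g \<longlonglongrightarrow> 0"
  proof (rule Lim_null_comparison)
    show "\<forall>\<^sub>F N in sequentially. norm (g N)
        \<le> 8 * (real (card (few_large_degrees n N :: 'a poly set)) / real CARD('a) ^ N)"
      using moebius_weight_partial_sum_bound[OF assms(2), where 'a = 'a] by (simp add: g_def)
    show "(\<lambda>N. 8 * (real (card (few_large_degrees n N :: 'a poly set)) / real CARD('a) ^ N)) \<longlonglongrightarrow> 0"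
      using tendsto_mult_right_zero[OF few_large_degrees_density[OF assms(2)]] .
  qed
  moreover have "filterlim (\<lambda>x::real. nat \<lfloor>x\<rfloor>) sequentially at_top" by real_asymp
  ultimately have "((\<lambda>x::real. g (nat \<lfloor>x\<rfloor>)) \<longlongrightarrow> 0) at_top" by (rule filterlim_compose)
  moreover have "?f x = g (nat \<lfloor>x\<rfloor>)" if "x \<ge> 0" for x
    unfolding g_def
  proof (rule sum.mono_neutral_cong_left)
    \<comment> \<open>Degrees are integers, so for \<open>x \<ge> 0\<close> the cutoffs
      \<open>x\<close> and its floor agree.\<close>
    have le: "real m \<le> x \<longleftrightarrow> m \<le> nat \<lfloor>x\<rfloor>" for m using that by (simp add: le_nat_iff le_floor_iff)
    show "finite {A :: 'a poly. lead_coeff A = 1 \<and> degree A \<le> nat \<lfloor>x\<rfloor>}"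
      by (rule finite_subset[OF _ finite_polys_degree_le[of "nat \<lfloor>x\<rfloor>"]]) auto
    show "{A :: 'a poly. lead_coeff A = 1 \<and> 1 \<le> degree A \<and> real (degree A) \<le> x \<and> least_prime_degree A = n}
        \<subseteq> {A. lead_coeff A = 1 \<and> degree A \<le> nat \<lfloor>x\<rfloor>}"
      by (auto simp: le)
    show "\<forall>A\<in>{A :: 'a poly. lead_coeff A = 1 \<and> degree A \<le> nat \<lfloor>x\<rfloor>}
        - {A. lead_coeff A = 1 \<and> 1 \<le> degree A \<and> real (degree A) \<le> x \<and> least_prime_degree A = n}.
        moebius_weight n A / real CARD('a) ^ degree A = 0"
    proof
      fix A assume A: "A \<in> {A :: 'a poly. lead_coeff A = 1 \<and> degree A \<le> nat \<lfloor>x\<rfloor>}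
        - {A. lead_coeff A = 1 \<and> 1 \<le> degree A \<and> real (degree A) \<le> x \<and> least_prime_degree A = n}"
      \<comment> \<open>The only monic polynomial of degree 0 is 1, with least prime degree 0, so
        including degree 0 in \<open>g\<close> adds nothing.\<close>
      have "least_prime_degree A \<noteq> n"
      proof (cases "degree A = 0")
        case True
        then have "A = 1" using A by (auto elim!: degree_eq_zeroE)
        then show ?thesis using assms(2) by (simp add: least_prime_degree_def)
      qed (use A le in auto)
      then show "moebius_weight n A / real CARD('a) ^ degree A = 0" by (simp add: moebius_weight_def)
    qed
  qed (auto simp: moebius_weight_def assms(1))
  then have "\<forall>\<^sub>F x in at_top. g (nat \<lfloor>x\<rfloor>) = ?f x"
    by (intro eventually_mono[OF eventually_ge_at_top[of 0]]) simp
  ultimately show ?thesis by (rule Lim_transform_eventually)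
qed

end
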